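(* Let $\mathbf{K}$ be a field, let $m>n\geq 1$ be integers, and let $f_1,\ldots,f_m\in\mathbf{K}[X_1,\ldots,X_n]$ be homogeneous polynomials of degree $2$ such that $\mathbf{K}[X_1,\ldots,X_n]/(f_1,\ldots,f_m)$ is finite-dimensional over $\mathbf{K}$ and $f_1,\ldots,f_m$ is a semi-regular sequence. Then the smaller root of $p(k)=k^2-(2m-n)k+\tfrac14 n^2$ yields the lower bound $$d_{reg}\geq 1+\left\lfloor \tfrac12\left(2m-n-2\sqrt{m(m-n)}\right)\right\rfloor.$$
   Context: For a graded algebra or homogeneous ideal, a subscript $d$ denotes the degree-$d$ homogeneous component. Let $J=(f_1,\ldots,f_m)$. The degree of regularity is $d_{reg}=\min\{d\geq 0: \dim_{\mathbf{K}} J_d=\dim_{\mathbf{K}}\mathbf{K}[X_1,\ldots,X_n]_d\}$. The sequence $f_1,\ldots,f_m$ is semi-regular if for each $i=1,\ldots,m$ and each $j<d_{reg}-2$ the multiplication map $S(i-1)_j\to S(i-1)_{j+2}$, $g\mapsto gf_i$, is injective, where $S(i-1)=\mathbf{K}[X_1,\ldots,X_n]/(f_1,\ldots,f_{i-1})$. *)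

theory Defs
  imports
    "HOL-Library.Cardinality"
    "HOL-Library.Poly_Mapping"
    "HOL-Algebra.QuotRing"
    "HOL-Algebra.Embedded_Algebras"
    "HOL-Algebra.Algebraic_Closure_Type"
begin

text \<open>A polynomial over \<open>'k\<close> in the variables \<open>X\<^sub>v\<close>, \<open>v :: 'n\<close>, is a finitely supported map
  from exponent vectors to coefficients, with the convolution product of
  \<^theory>\<open>HOL-Library.Poly_Mapping\<close>. The number of variables is \<open>CARD('n)\<close>.\<close>

type_synonym ('n, 'k) mpoly = "('n \<Rightarrow>\<^sub>0 nat) \<Rightarrow>\<^sub>0 'k"

abbreviation poly_ring :: "('n::finite, 'k::field) mpoly ring"
  where "poly_ring \<equiv> ring_of_type_algebra"

definition scalars :: "('n::finite, 'k::field) mpoly set"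
  where "scalars = range (Poly_Mapping.single 0)"

definition mon_deg :: "('n::finite \<Rightarrow>\<^sub>0 nat) \<Rightarrow> nat"
  where "mon_deg t = (\<Sum>v\<in>UNIV. Poly_Mapping.lookup t v)"

text \<open>The homogeneous component of degree \<open>d\<close>; as a vector space it contains \<open>0\<close>.\<close>

definition homog :: "nat \<Rightarrow> ('n::finite, 'k::field) mpoly set"
  where "homog d = {p. \<forall>t\<in>Poly_Mapping.keys p. mon_deg t = d}"

definition seq_ideal :: "(nat \<Rightarrow> ('n::finite, 'k::field) mpoly) \<Rightarrow> nat \<Rightarrow> ('n, 'k) mpoly set"
  where "seq_ideal f i = genideal poly_ring (f ` {1..i})"

definition seq_quot ::
    "(nat \<Rightarrow> ('n::finite, 'k::field) mpoly) \<Rightarrow> nat \<Rightarrow> ('n, 'k) mpoly set ring"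
  where "seq_quot f i = poly_ring Quot seq_ideal f i"

definition seq_class ::
    "(nat \<Rightarrow> ('n::finite, 'k::field) mpoly) \<Rightarrow> nat \<Rightarrow> ('n, 'k) mpoly \<Rightarrow> ('n, 'k) mpoly set"
  where "seq_class f i g = seq_ideal f i +>\<^bsub>poly_ring\<^esub> g"

text \<open>The grading of the quotient is the one induced by the projection, and its scalars are the
  classes of the constant polynomials.\<close>

definition seq_quot_homog ::
    "(nat \<Rightarrow> ('n::finite, 'k::field) mpoly) \<Rightarrow> nat \<Rightarrow> nat \<Rightarrow> ('n, 'k) mpoly set set"
  where "seq_quot_homog f i d = seq_class f i ` homog d"

definition seq_quot_finite_dim :: "(nat \<Rightarrow> ('n::finite, 'k::field) mpoly) \<Rightarrow> nat \<Rightarrow> bool"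
  where "seq_quot_finite_dim f i \<longleftrightarrow>
    ring.finite_dimension (seq_quot f i) (seq_class f i ` scalars) (carrier (seq_quot f i))"

text \<open>If no degree \<open>d\<close> qualifies, the \<open>LEAST\<close> is unspecified; for homogeneous \<open>f 1, \<dots>, f m\<close>
  such a \<open>d\<close> exists as soon as the quotient by them is finite-dimensional.\<close>

definition deg_reg :: "(nat \<Rightarrow> ('n::finite, 'k::field) mpoly) \<Rightarrow> nat \<Rightarrow> nat"
  where "deg_reg f m = (LEAST d.
    ring.dim poly_ring scalars (seq_ideal f m \<inter> homog d) =
    ring.dim poly_ring scalars (homog d :: ('n, 'k) mpoly set))"

text \<open>For quadratic forms. The bound \<open>j < deg_reg f m - 2\<close> is written additively because
  subtraction on \<^typ>\<open>nat\<close> truncates.\<close>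

definition semi_regular :: "(nat \<Rightarrow> ('n::finite, 'k::field) mpoly) \<Rightarrow> nat \<Rightarrow> bool"
  where "semi_regular f m \<longleftrightarrow>
    (\<forall>i\<in>{1..m}. \<forall>j. j + 2 < deg_reg f m \<longrightarrow>
      inj_on (\<lambda>C. C \<otimes>\<^bsub>seq_quot f (i - 1)\<^esub> seq_class f (i - 1) (f i))
             (seq_quot_homog f (i - 1) j))"

end

theory Submission
  imports Defs "HOL-Computational_Algebra.Formal_Power_Series"
begin

text \<open>Let \<open>D\<close> be the degree of regularity and \<open>h\<^sub>i(d) = dim S(i)\<^sub>d\<close>. Multiplication by \<open>f\<^sub>i\<^sub>+\<^sub>1\<close> gives
  \<open>h\<^sub>i\<^sub>+\<^sub>1(d) \<ge> h\<^sub>i(d) - h\<^sub>i(d - 2)\<close>, with equality when it is injective, hence for \<open>d < D\<close>. Starting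
  from the Hilbert series \<open>(1 - z)\<^sup>-\<^sup>n\<close> of the polynomial ring, the coefficient of \<open>z\<^sup>D\<close> in
  \<open>(1 - z)\<^sup>-\<^sup>n (1 - z\<^sup>2)\<^sup>m = (1 - z)\<^sup>m\<^sup>-\<^sup>n (1 + z)\<^sup>m\<close> is therefore at most \<open>h\<^sub>m(D) = 0\<close>. These coefficients
  \<open>c\<^sub>k\<close> are values of Krawtchouk polynomials. With \<open>N = 2m - n\<close>, they satisfy
  \<open>(k + 1) c\<^sub>k\<^sub>+\<^sub>1 = n c\<^sub>k - (N - k + 1) c\<^sub>k\<^sub>-\<^sub>1\<close>. As long as \<open>p(k) \<ge> 0\<close>, the smaller root \<open>w\<^sub>k\<close> of
  \<open>w (n - w) = k (N - k)\<close> is real, and the recurrence preserves \<open>w\<^sub>k c\<^sub>k \<ge> (N - k) c\<^sub>k\<^sub>-\<^sub>1\<close>, so that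
  \<open>c\<^sub>k > 0\<close> for every \<open>k\<close> up to the smaller root of \<open>p\<close>. Hence \<open>D\<close> exceeds that root.\<close>

subsection \<open>Positivity of Krawtchouk coefficients\<close>

text \<open>The map \<open>u * (n - u)\<close> increases up to n / 2, and at k y / (k + 1) its value
  is already at least \<open>k * (N - k)\<close>, so \<open>x\<close> cannot lie beyond that point.
  In the application \<open>x\<close> and \<open>y\<close> are the consecutive roots
  \<open>w k\<close> and \<open>w (Suc k)\<close>.\<close>

lemma quadratic_roots_ratio:
  fixes k n N x y :: real
  assumes "k > 0" "n \<le> N" "2 * (k + 1) \<le> n" "0 \<le> x" "2 * x \<le> n" "0 \<le> y" "2 * y \<le> n"
    and x: "x * (n - x) = k * (N - k)"
    and y: "y * (n - y) = (k + 1) * (N - (k + 1))"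
  shows "(k + 1) * x \<le> k * y"
proof -
  have mono: "u * (n - u) < v * (n - v)" if "u < v" "2 * v \<le> n" for u v :: real
  proof -
    have "v * (n - v) - u * (n - u) = (v - u) * (n - u - v)" by (simp add: algebra_simps)
    moreover have "(v - u) * (n - u - v) > 0" using that by (intro mult_pos_pos) auto
    ultimately show ?thesis by linarith
  qed
  have "k + 1 \<le> y"
  proof (rule ccontr)
    assume "\<not> k + 1 \<le> y"
    then have "y * (n - y) < (k + 1) * (n - (k + 1))" using assms by (intro mono) auto
    also have "\<dots> \<le> (k + 1) * (N - (k + 1))" using assms by (intro mult_left_mono) auto
    finally show False using y by simp
  qed
  \<comment> \<open>Passing from \<open>y\<close> to \<open>k * s\<close> = y - s raises
    \<open>s * (n - y)\<close> by \<open>s * s\<close>, which is at least 1: exactly the step from N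
    - (k + 1) to N - k.\<close>
  define s where "s = y / (k + 1)"
  have s1: "s \<ge> 1" and ys: "y = (k + 1) * s"
    using \<open>k + 1 \<le> y\<close> assms(1) by (auto simp: s_def field_simps)
  have "x \<le> k * s"
  proof (rule ccontr)
    assume "\<not> x \<le> k * s"
    then have "k * s * (n - k * s) < k * (N - k)" using mono[of "k * s" x] assms x by auto
    then have "s * (n - k * s) < N - k" using assms(1) by (simp add: mult.assoc)
    moreover have "s * (n - y) = N - (k + 1)"
      using y assms(1) ys by (simp add: mult.assoc)
    moreover have "s * (n - k * s) = s * (n - y) + s * s" unfolding ys by (simp add: algebra_simps)
    moreover have "s * s \<ge> 1" using s1 mult_mono[of 1 s 1 s] by auto
    ultimately show False by linarith
  qed
  then have "(k + 1) * x \<le> (k + 1) * (k * s)" using assms(1) by (intro mult_left_mono) auto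
  then show ?thesis unfolding ys by (simp add: mult.left_commute)
qed

text \<open>The ratio bound \<open>(N - real k) * c (k - 1) \<le> w k * c k\<close> propagates
  through the recurrence. The two conditions on \<open>K\<close> place it at or below the smaller
  root of k^2 - N k + n^2 / 4.\<close>

lemma recurrence_pos:
  fixes c :: "nat \<Rightarrow> real" and n N :: real
  assumes n: "0 < n" "n \<le> N"
    and c0: "c 0 = 1" and c1: "c 1 = n"
    and rec: "\<And>k. k \<ge> 1 \<Longrightarrow> (real k + 1) * c (k + 1) = n * c k - (N - real k + 1) * c (k - 1)"
    and K: "4 * real K * (N - real K) \<le> n\<^sup>2" "2 * real K \<le> N"
  shows "c K > 0"
proof -
  \<comment> \<open>Since k (N - k) increases up to N / 2, the bound at \<open>K\<close> passes down
    to smaller k. If 2 k > n, then 2 (N - k) \<ge> N \<ge> n would force 4 k (N - k) > n^2.\<close>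
  have disc: "4 * real k * (N - real k) \<le> n\<^sup>2" "2 * real k \<le> n" if "k \<le> K" for k
  proof -
    have "(real K - real k) * (N - real K - real k) \<ge> 0"
      using that K(2) by (intro mult_nonneg_nonneg) (auto simp: of_nat_mono)
    then have "real k * (N - real k) \<le> real K * (N - real K)" by (simp add: algebra_simps)
    then show le: "4 * real k * (N - real k) \<le> n\<^sup>2" using K(1) by simp
    show "2 * real k \<le> n"
    proof (rule ccontr)
      assume A: "\<not> 2 * real k \<le> n"
      have "2 * real k \<le> N" using that K(2) by simp
      have "n * n < (2 * real k) * n" using A n by simp
      also have "\<dots> \<le> (2 * real k) * (2 * (N - real k))"
        using \<open>2 * real k \<le> N\<close> n by (intro mult_left_mono) auto
      also have "\<dots> \<le> n * n" using le by (simp add: power2_eq_square algebra_simps)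
      finally show False by simp
    qed
  qed
  define w where "w k = (n - sqrt (n\<^sup>2 - 4 * real k * (N - real k))) / 2" for k
  have w: "0 \<le> w k" "2 * w k \<le> n" "w k * (n - w k) = real k * (N - real k)" if "k \<le> K" for k
  proof -
    define s where "s = sqrt (n\<^sup>2 - 4 * real k * (N - real k))"
    have s2: "s * s = n * n - 4 * real k * (N - real k)" and "s \<ge> 0"
      using disc(1)[OF that] by (simp_all add: s_def power2_eq_square)
    moreover have "N - real k \<ge> 0" using that K(2) of_nat_0_le_iff[of K] of_nat_mono[OF that] by linarith
    ultimately have "s * s \<le> n * n" by (smt (verit) mult_nonneg_nonneg of_nat_0_le_iff)
    then have "s \<le> n" using n power2_le_imp_le[of s n] by (simp add: power2_eq_square)
    then show "0 \<le> w k" "2 * w k \<le> n" using \<open>s \<ge> 0\<close> by (simp_all add: w_def flip: s_def)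
    have "w k * (n - w k) = (n * n - s * s) / 4"
      by (simp add: w_def flip: s_def) (simp add: field_simps)
    then show "w k * (n - w k) = real k * (N - real k)" using s2 by simp
  qed
  \<comment> \<open>The induction starts at 1, where \<open>c (k - 1)\<close> is a true predecessor.
    The base case is n w_1 \<ge> w_1 (n - w_1) = N - 1.\<close>
  have inv: "c k > 0 \<and> (N - real k) * c (k - 1) \<le> w k * c k" if "1 \<le> k" "k \<le> K" for k
    using that
  proof (induction k rule: nat_induct_at_least)
    case base
    then have "w 1 * (n - w 1) = N - 1" using w(3)[of 1] by simp
    moreover have "w 1 * (n - w 1) \<le> w 1 * n" using w(1)[of 1] base by (intro mult_left_mono) auto
    ultimately show ?case using c0 c1 n by simp
  next
    case (Suc k)
    then have IH: "c k > 0" "(N - real k) * c (k - 1) \<le> w k * c k" and le: "Suc k \<le> K" "k \<le> K" by auto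
    have k0: "real k > 0" using Suc.hyps by simp
    have kN: "2 * real k + 2 \<le> N" using le K by (smt (verit) of_nat_mono of_nat_Suc)
    have "(real k + 1) * w k \<le> real k * w (Suc k)"
      using quadratic_roots_ratio[of "real k" n N "w k" "w (Suc k)"] disc(2)[OF le(1)]
        w[OF le(1)] w[OF le(2)] k0 n by (simp add: add.commute)
    \<comment> \<open>As k \<le> N - k, the factor k may be enlarged to N - k. The resulting
      \<open>ww\<close> absorbs the coefficient N - k + 1 of the recurrence.\<close>
    then have wd: "w k \<le> real k * (w (Suc k) - w k)" by (simp add: algebra_simps)
    then have "w (Suc k) - w k \<ge> 0"
      using w(1)[OF le(2)] k0 by (smt (verit) mult_pos_neg)
    then have "w k \<le> (N - real k) * (w (Suc k) - w k)"
      using wd kN k0 by (smt (verit) mult_right_mono)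
    then have ww: "(N - real k + 1) * w k \<le> (N - real k) * w (Suc k)" by (simp add: algebra_simps)
    have Nk: "N - real k > 0" using kN k0 by linarith
    have "(N - real k) * ((N - real k + 1) * c (k - 1)) \<le> (N - real k + 1) * (w k * c k)"
      using IH(2) Nk by (smt (verit) mult.left_commute mult_left_mono)
    also have "\<dots> \<le> (N - real k) * w (Suc k) * c k"
      using mult_right_mono[OF ww, of "c k"] IH(1) by (simp add: mult.assoc)
    finally have "(N - real k + 1) * c (k - 1) \<le> w (Suc k) * c k"
      using Nk by (simp add: mult.assoc)
    then have low: "(n - w (Suc k)) * c k \<le> (real k + 1) * c (Suc k)"
      using rec[of k] Suc.hyps by (simp add: algebra_simps)
    moreover have "(n - w (Suc k)) * c k > 0"
      using w(1,2)[OF le(1)] n IH(1) by (intro mult_pos_pos) auto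
    ultimately have pos: "c (Suc k) > 0" by (smt (verit) mult_nonneg_nonpos of_nat_0_le_iff)
    \<comment> \<open>Multiplying \<open>low\<close> by \<open>w (Suc k)\<close> restores the
      invariant, because w (n - w) = (k + 1) (N - (k + 1)) at this root.\<close>
    have "(real k + 1) * ((N - real (Suc k)) * c k) = w (Suc k) * ((n - w (Suc k)) * c k)"
      using w(3)[OF le(1)] by (simp add: mult.assoc[symmetric] add.commute)
    also have "\<dots> \<le> w (Suc k) * ((real k + 1) * c (Suc k))"
      using low w(1)[OF le(1)] by (rule mult_left_mono)
    finally have "(real k + 1) * ((N - real (Suc k)) * c k) \<le> (real k + 1) * (w (Suc k) * c (Suc k))"
      by (simp add: mult.left_commute)
    then have "(N - real (Suc k)) * c k \<le> w (Suc k) * c (Suc k)"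
      using k0 by (subst (asm) mult_le_cancel_left_pos) auto
    then show ?case using pos by simp
  qed
  show ?thesis using inv[of K] c0 by (cases "K = 0") auto
qed

text \<open>This is the logarithmic derivative b / (1 + X) - a / (1 - X) of \<open>G\<close>,
  cleared of denominators. Its coefficients give the three-term recurrence.\<close>

lemma fps_krawtchouk_deriv:
  fixes a b :: nat
  defines "G \<equiv> (1 - fps_X) ^ a * (1 + fps_X) ^ b :: real fps"
  shows "fps_deriv G * (1 - fps_X\<^sup>2) = G * (fps_const (real b - real a) - fps_const (real a + real b) * fps_X)"
proof -
  \<comment> \<open>The extra factor \<open>g\<close> avoids the exponent k - 1, which truncates at
    k = 0.\<close>
  have pow: "fps_deriv (g ^ k) * g = fps_const (real k) * fps_deriv g * g ^ k" for g :: "real fps" and k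
  proof (induction k)
    case (Suc k)
    have "fps_deriv (g ^ Suc k) * g = fps_deriv g * g ^ Suc k + g * (fps_deriv (g ^ k) * g)"
      by (simp add: algebra_simps)
    also have "\<dots> = fps_const (real (Suc k)) * fps_deriv g * g ^ Suc k"
      by (subst Suc) (simp add: algebra_simps flip: fps_const_add)
    finally show ?case .
  qed simp
  have A: "fps_deriv ((1 - fps_X) ^ a) * (1 - fps_X) = - fps_const (real a) * (1 - fps_X :: real fps) ^ a"
    by (simp add: pow)
  have B: "fps_deriv ((1 + fps_X) ^ b) * (1 + fps_X) = fps_const (real b) * (1 + fps_X :: real fps) ^ b"
    by (simp add: pow)
  define P Q where "P = (1 - fps_X :: real fps) ^ a" and "Q = (1 + fps_X :: real fps) ^ b"
  have "fps_deriv G * (1 - fps_X\<^sup>2)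
      = (fps_deriv P * (1 - fps_X)) * Q * (1 + fps_X) + P * (fps_deriv Q * (1 + fps_X)) * (1 - fps_X)"
    by (simp add: G_def P_def Q_def) (simp add: algebra_simps power2_eq_square)
  also have "\<dots> = (- fps_const (real a) * P) * Q * (1 + fps_X) + P * (fps_const (real b) * Q) * (1 - fps_X)"
    using A B by (simp add: P_def Q_def)
  also have "\<dots> = P * Q * ((fps_const (real b) - fps_const (real a)) - (fps_const (real a) + fps_const (real b)) * fps_X)"
    by (simp add: algebra_simps flip: fps_const_add fps_const_sub fps_const_neg)
  finally show ?thesis by (simp add: G_def P_def Q_def)
qed

text \<open>The bound on \<open>K\<close> is the smaller root of k^2 - (a + b) k + (b - a)^2 / 4,
  whose discriminant is 4 a b. With a = m - n and b = m this is the polynomial p of the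
  theorem.\<close>

lemma fps_krawtchouk_nth_pos:
  includes fps_syntax
  fixes a b K :: nat
  assumes "a < b" and K: "real K \<le> (real a + real b) / 2 - sqrt (real a * real b)"
  shows "((1 - fps_X) ^ a * (1 + fps_X) ^ b :: real fps) $ K > 0"
proof -
  define G where "G = ((1 - fps_X) ^ a * (1 + fps_X) ^ b :: real fps)"
  note D = fps_krawtchouk_deriv[of a b, folded G_def]
  \<comment> \<open>\<open>nthD\<close> and \<open>nthL\<close> read the same coefficient off the
    two sides of the differential equation; equating them gives the recurrence with n = b - a and N
    = a + b.\<close>
  have nthD: "(fps_deriv G * (1 - fps_X\<^sup>2)) $ k =
      (real b - real a) * G $ k - (real a + real b) * (if k = 0 then 0 else G $ (k - 1))" for k
    unfolding D by (simp add: right_diff_distrib mult.assoc[symmetric] mult.commute[of G])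
  have nthL: "(fps_deriv G * (1 - fps_X\<^sup>2)) $ k =
      (real k + 1) * G $ (k + 1) - (if k < 2 then 0 else (real k - 1) * G $ (k - 1))" for k
  proof (cases "k < 2")
    case False
    then obtain j where "k = Suc (Suc j)" using add_2_eq_Suc le_Suc_ex not_less by metis
    then show ?thesis by (simp add: right_diff_distrib fps_X_power_mult_right_nth algebra_simps)
  qed (simp add: right_diff_distrib fps_X_power_mult_right_nth algebra_simps)
  have G0: "G $ 0 = 1" by (simp add: G_def fps_nth_power_0)
  have "G $ K > 0"
  proof (rule recurrence_pos[where n = "real b - real a" and N = "real a + real b"])
    show "G $ 1 = real b - real a" using nthD[of 0] nthL[of 0] G0 by simp
    show "(real k + 1) * G $ (k + 1) = (real b - real a) * G $ k - (real a + real b - real k + 1) * G $ (k - 1)"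
      if "k \<ge> 1" for k
      using nthD[of k] nthL[of k] that by (cases "k = 1") (auto simp: algebra_simps)
    define s where "s = sqrt (real a * real b)"
    have s: "s * s = real a * real b" "s \<ge> 0" by (simp_all add: s_def)
    have Ks: "s \<le> (real a + real b) / 2 - real K" using K by (simp add: s_def)
    then show "2 * real K \<le> real a + real b" using s(2) by (simp add: field_simps)
    have "real a * real b \<le> ((real a + real b) / 2 - real K) * ((real a + real b) / 2 - real K)"
      using mult_mono[OF Ks Ks] s order_trans[OF s(2) Ks] by simp
    then show "4 * real K * (real a + real b - real K) \<le> (real b - real a)\<^sup>2"
      by (simp add: power2_eq_square field_simps)
  qed (use assms G0 in auto)
  then show ?thesis by (simp add: G_def)
qed

subsection \<open>Dimensions of vector spaces\<close>

context vector_space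
begin

text \<open>A space with an infinite basis has \<open>dim\<close> 0, so monotonicity is stated
  inside a finite span.\<close>

lemma dim_mono_finite_span:
  assumes "U \<subseteq> V" "V \<subseteq> span S" "finite S"
  shows "dim U \<le> dim V"
proof -
  obtain B where B: "B \<subseteq> V" "independent B" "V \<subseteq> span B" "card B = dim V" by (rule basis_exists)
  have "finite B" using independent_span_bound[of S B] assms B by auto
  then show ?thesis using dim_le_card[of U B] assms B by auto
qed

text \<open>Rank-nullity for the map from \<open>H\<close> to the quotient by \<open>W\<close>
  induced by \<open>\<phi>\<close>, phrased without quotients. A basis of \<open>W\<close>, joined
  with the images of basis vectors of \<open>H\<close> that complement the kernel, is a basis of the
  sum.\<close>

lemma dim_plus_image:
  assumes lin: "Vector_Spaces.linear scale scale \<phi>"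
    and sub: "subspace W" "subspace H"
    and fin: "W \<subseteq> span S" "finite S" "H \<subseteq> span T" "finite T"
  shows "dim {w + \<phi> h | w h. w \<in> W \<and> h \<in> H} + dim {h \<in> H. \<phi> h \<in> W} = dim W + dim H"
proof -
  interpret Vector_Spaces.linear scale scale \<phi> by (rule lin)
  define K where "K = {h \<in> H. \<phi> h \<in> W}"
  have K: "subspace K"
    using sub unfolding K_def subspace_def by (auto simp: zero add scale)
  obtain Bk where Bk: "Bk \<subseteq> K" "independent Bk" "K \<subseteq> span Bk" "card Bk = dim K"
    by (rule basis_exists)
  have "Bk \<subseteq> H" using Bk by (auto simp: K_def)
  then obtain B where B: "Bk \<subseteq> B" "B \<subseteq> H" "independent B" "H \<subseteq> span B"
    using maximal_independent_subset_extend Bk(2) by metis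
  obtain C where C: "C \<subseteq> W" "independent C" "W \<subseteq> span C" "card C = dim W" by (rule basis_exists)
  have finB: "finite B" using independent_span_bound[of T B] B fin by auto
  have finC: "finite C" using independent_span_bound[of S C] C fin by auto
  have spanC: "span C = W" using C sub span_minimal by blast
  have cardB: "card B = dim H" using B basis_card_eq_dim by blast
  \<comment> \<open>Images are added one at a time; the cardinality claim records that they are
    distinct and lie outside \<open>C\<close>.\<close>
  have ext: "independent (C \<union> \<phi> ` A) \<and> card (C \<union> \<phi> ` A) = card C + card A"
    if "finite A" "A \<subseteq> B - Bk" for A
    using that
  proof (induction A)
    case empty
    then show ?case using C by simp
  next
    case (insert a A)
    have notin: "\<phi> a \<notin> span (C \<union> \<phi> ` A)"
    proof
      assume "\<phi> a \<in> span (C \<union> \<phi> ` A)"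
      then obtain x y where xy: "x \<in> span C" "y \<in> span (\<phi> ` A)" "\<phi> a = x + y"
        by (auto simp: span_Un)
      then obtain z where z: "z \<in> span A" "y = \<phi> z" by (auto simp: span_image)
      \<comment> \<open>The difference \<open>a - z\<close> falls into the kernel \<open>K\<close>,
        so \<open>a\<close> would depend on \<open>Bk\<close> and \<open>A\<close>, against the
        independence of \<open>B\<close>.\<close>
      have "z \<in> H" using z(1) insert.prems B(2) sub(2) span_minimal[of A H] by blast
      moreover have "a \<in> H" using insert.prems B by auto
      moreover have "\<phi> (a - z) \<in> W" using xy z spanC by (simp add: diff)
      ultimately have "a - z \<in> K" using sub by (simp add: K_def subspace_diff)
      then have "a - z \<in> span (Bk \<union> A)" using Bk(3) span_mono[of Bk "Bk \<union> A"] by blast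
      moreover have "z \<in> span (Bk \<union> A)" using z(1) span_mono[of A "Bk \<union> A"] by blast
      ultimately have "a \<in> span (Bk \<union> A)" using span_add by fastforce
      moreover have "Bk \<union> A \<subseteq> B - {a}" using insert.prems insert.hyps B by auto
      ultimately have "a \<in> span (B - {a})" using span_mono by blast
      then show False using B(3) insert.prems unfolding dependent_def by blast
    qed
    then have "\<phi> a \<notin> C \<union> \<phi> ` A" using span_base by metis
    moreover have "independent (C \<union> \<phi> ` A)" "card (C \<union> \<phi> ` A) = card C + card A"
      using insert by auto
    ultimately show ?case
      using notin insert.hyps finC by (auto simp: independent_insert)
  qed
  define Z where "Z = {w + \<phi> h | w h. w \<in> W \<and> h \<in> H}"
  have ind: "independent (C \<union> \<phi> ` (B - Bk))" "card (C \<union> \<phi> ` (B - Bk)) = card C + card (B - Bk)"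
    using ext[of "B - Bk"] finB by auto
  have "C \<union> \<phi> ` (B - Bk) \<subseteq> Z"
  proof
    fix v assume "v \<in> C \<union> \<phi> ` (B - Bk)"
    then consider "v \<in> W" | h where "h \<in> H" "v = \<phi> h" using C(1) B(2) by blast
    then show "v \<in> Z"
    proof cases
      case 1
      then have "v = v + \<phi> 0" "0 \<in> H" using sub by (auto simp: zero subspace_0)
      then show ?thesis using 1 unfolding Z_def by blast
    next
      case 2
      then have "v = 0 + \<phi> h" "0 \<in> W" using sub by (auto simp: subspace_0)
      then show ?thesis using 2 unfolding Z_def by blast
    qed
  qed
  moreover have "Z \<subseteq> span (C \<union> \<phi> ` (B - Bk))"
  proof -
    have W: "W \<subseteq> span (C \<union> \<phi> ` (B - Bk))" using C(3) span_mono[of C "C \<union> \<phi> ` (B - Bk)"] by blast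
    have "\<phi> ` B \<subseteq> span (C \<union> \<phi> ` (B - Bk))"
    proof
      fix v assume "v \<in> \<phi> ` B"
      then obtain b where b: "b \<in> B" "v = \<phi> b" by blast
      show "v \<in> span (C \<union> \<phi> ` (B - Bk))"
        using b Bk(1) W span_base[of v "C \<union> \<phi> ` (B - Bk)"] by (cases "b \<in> Bk") (auto simp: K_def)
    qed
    then have "span (\<phi> ` B) \<subseteq> span (C \<union> \<phi> ` (B - Bk))" by (simp add: span_minimal)
    moreover have "\<phi> ` H \<subseteq> span (\<phi> ` B)" using B(4) by (auto simp: span_image)
    ultimately show ?thesis using W by (auto simp: Z_def intro!: span_add)
  qed
  ultimately have "dim Z = card C + card (B - Bk)"
    using basis_card_eq_dim ind by metis
  moreover have "card (B - Bk) + card Bk = card B"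
    using B(1) finB by (metis card_Diff_subset card_mono finite_subset le_add_diff_inverse2)
  ultimately show ?thesis using Bk(4) C(4) cardB by (simp add: Z_def K_def)
qed

end

subsection \<open>Homogeneous polynomials\<close>

lemma mon_deg_add: "mon_deg (s + t) = mon_deg s + mon_deg t"
  by (simp add: mon_deg_def lookup_add sum.distrib)

text \<open>Stars and bars: enumerating the variables turns exponent vectors into lists of naturals
  with prescribed length and sum.\<close>

lemma card_mon_deg:
  "finite {t :: 'n::finite \<Rightarrow>\<^sub>0 nat. mon_deg t = d}"
  "card {t :: 'n::finite \<Rightarrow>\<^sub>0 nat. mon_deg t = d} = (d + CARD('n) - 1) choose d"
proof -
  obtain vs :: "'n list" where vs: "set vs = UNIV" "distinct vs"
    using finite_distinct_list[of "UNIV :: 'n set"] by auto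
  have len: "length vs = CARD('n)" using vs distinct_card by metis
  have "bij_betw (\<lambda>t. map (Poly_Mapping.lookup t) vs) {t :: 'n \<Rightarrow>\<^sub>0 nat. mon_deg t = d}
      {l. length l = CARD('n) \<and> sum_list l = d}"
  proof (rule bij_betwI')
    fix s t :: "'n \<Rightarrow>\<^sub>0 nat"
    show "map (Poly_Mapping.lookup s) vs = map (Poly_Mapping.lookup t) vs \<longleftrightarrow> s = t"
      using vs by (auto intro: poly_mapping_eqI)
  next
    fix t :: "'n \<Rightarrow>\<^sub>0 nat" assume "t \<in> {t. mon_deg t = d}"
    then show "map (Poly_Mapping.lookup t) vs \<in> {l. length l = CARD('n) \<and> sum_list l = d}"
      using vs len by (simp add: mon_deg_def sum_list_distinct_conv_sum_set)
  next
    fix l assume l: "l \<in> {l :: nat list. length l = CARD('n) \<and> sum_list l = d}"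
    define t where "t = Abs_poly_mapping (\<lambda>v. the (map_of (zip vs l) v))"
    have lt: "Poly_Mapping.lookup t v = the (map_of (zip vs l) v)" for v
      by (simp add: t_def)
    have map: "map (Poly_Mapping.lookup t) vs = l"
      using vs l len by (intro nth_equalityI) (auto simp: lt map_of_zip_nth)
    moreover have "mon_deg t = sum_list (map (Poly_Mapping.lookup t) vs)"
      using vs by (simp add: mon_deg_def sum_list_distinct_conv_sum_set)
    ultimately show "\<exists>t\<in>{t. mon_deg t = d}. l = map (Poly_Mapping.lookup t) vs" using l by auto
  qed
  then have bij: "card {t :: 'n \<Rightarrow>\<^sub>0 nat. mon_deg t = d} = card {l :: nat list. length l = CARD('n) \<and> sum_list l = d}"
    and fin: "finite {t :: 'n \<Rightarrow>\<^sub>0 nat. mon_deg t = d} = finite {l :: nat list. length l = CARD('n) \<and> sum_list l = d}"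
    using bij_betw_same_card bij_betw_finite by blast+
  show "card {t :: 'n::finite \<Rightarrow>\<^sub>0 nat. mon_deg t = d} = (d + CARD('n) - 1) choose d"
    unfolding bij by (rule card_length_sum_list)
  have "{l :: nat list. length l = CARD('n) \<and> sum_list l = d} \<subseteq> {l. set l \<subseteq> {..d} \<and> length l = CARD('n)}"
    by (auto dest: member_le_sum_list)
  then show "finite {t :: 'n::finite \<Rightarrow>\<^sub>0 nat. mon_deg t = d}"
    unfolding fin using finite_lists_length_eq[of "{..d}"] finite_subset by blast
qed

text \<open>Scaling as a product with a constant polynomial makes ideals subspaces by absorption and
  agrees with \<open>scalars\<close>. Hilbert functions are computed with the resulting
  \<open>mpoly.dim\<close>; the \<open>ring.dim\<close> of \<open>deg_reg\<close> is eliminated in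
  \<open>deg_reg_eq\<close>.\<close>

definition mscale :: "'k \<Rightarrow> ('n::finite, 'k::field) mpoly \<Rightarrow> ('n, 'k) mpoly"
  where "mscale c p = Poly_Mapping.single 0 c * p"

lemma lookup_mscale [simp]: "Poly_Mapping.lookup (mscale c p) t = c * Poly_Mapping.lookup p t"
  by (simp add: mscale_def map.rep_eq when_def flip: mult_map_scale_conv_mult)

interpretation mpoly: vector_space mscale
  by unfold_locales (auto intro!: poly_mapping_eqI simp: lookup_add algebra_simps)

lemma linear_mult_right: "Vector_Spaces.linear mscale mscale (\<lambda>g. g * f)"
  by unfold_locales (simp_all add: mscale_def algebra_simps)

lemma homog_iff: "p \<in> homog d \<longleftrightarrow> (\<forall>t. mon_deg t \<noteq> d \<longrightarrow> Poly_Mapping.lookup p t = 0)"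
  by (auto simp: homog_def in_keys_iff)

lemma subspace_homog: "mpoly.subspace (homog d)"
  by (rule mpoly.subspaceI) (auto simp: homog_iff lookup_add)

lemma homog_mult: "p \<in> homog d \<Longrightarrow> q \<in> homog e \<Longrightarrow> p * q \<in> homog (d + e)"
  using keys_mult[of p q] by (fastforce simp: homog_def mon_deg_add)

lemma single_in_homog: "Poly_Mapping.single t c \<in> homog (mon_deg t)"
  by (simp add: homog_def)

lemma poly_mapping_sum_single: "p = (\<Sum>t\<in>Poly_Mapping.keys p. Poly_Mapping.single t (Poly_Mapping.lookup p t))"
  by (rule poly_mapping_eqI) (auto simp: lookup_sum lookup_single when_def sum.delta' in_keys_iff)

definition monomials :: "nat \<Rightarrow> ('n::finite, 'k::field) mpoly set"
  where "monomials d = (\<lambda>t. Poly_Mapping.single t 1) ` {t. mon_deg t = d}"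

lemma finite_monomials: "finite (monomials d)"
  by (simp add: monomials_def card_mon_deg)

lemma homog_subset_span: "homog d \<subseteq> mpoly.span (monomials d)"
proof
  fix p :: "('n::finite, 'k::field) mpoly" assume p: "p \<in> homog d"
  have "Poly_Mapping.single t (Poly_Mapping.lookup p t) \<in> mpoly.span (monomials d)" if "t \<in> Poly_Mapping.keys p" for t
  proof -
    have "Poly_Mapping.single t (Poly_Mapping.lookup p t) = mscale (Poly_Mapping.lookup p t) (Poly_Mapping.single t 1)"
      by (simp add: mscale_def mult_single)
    moreover have "Poly_Mapping.single t 1 \<in> monomials d"
      using that p by (auto simp: monomials_def homog_def)
    ultimately show ?thesis by (metis mpoly.span_base mpoly.span_scale)
  qed
  then show "p \<in> mpoly.span (monomials d)"
    by (subst poly_mapping_sum_single) (rule mpoly.span_sum)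
qed

lemma independent_monomials: "mpoly.independent (monomials d)"
  unfolding mpoly.dependent_def
proof
  assume "\<exists>a\<in>monomials d. a \<in> mpoly.span (monomials d - {a} :: ('n::finite, 'k::field) mpoly set)"
  then obtain t :: "'n \<Rightarrow>\<^sub>0 nat" where t: "Poly_Mapping.single t 1 \<in> 
      mpoly.span (monomials d - {Poly_Mapping.single t (1 :: 'k)})"
    by (auto simp: monomials_def)
  \<comment> \<open>The coefficient at \<open>t\<close> vanishes on every other monomial, hence on
    their span.\<close>
  have "mpoly.subspace {p :: ('n, 'k) mpoly. Poly_Mapping.lookup p t = 0}"
    by (rule mpoly.subspaceI) (auto simp: lookup_add)
  moreover have "monomials d - {Poly_Mapping.single t (1 :: 'k)} \<subseteq> {p. Poly_Mapping.lookup p t = 0}"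
    by (auto simp: monomials_def lookup_single when_def)
  ultimately have "mpoly.span (monomials d - {Poly_Mapping.single t (1 :: 'k)}) \<subseteq> {p. Poly_Mapping.lookup p t = 0}"
    by (rule mpoly.span_minimal[rotated])
  then show False using t by auto
qed

lemma dim_homog: "mpoly.dim (homog d :: ('n::finite, 'k::field) mpoly set) = (d + CARD('n) - 1) choose d"
proof -
  have "(monomials d :: ('n, 'k) mpoly set) \<subseteq> homog d"
    using single_in_homog by (fastforce simp: monomials_def)
  then have "mpoly.dim (homog d :: ('n, 'k) mpoly set) = card (monomials d :: ('n, 'k) mpoly set)"
    using mpoly.basis_card_eq_dim homog_subset_span independent_monomials by metis
  also have "\<dots> = card {t :: 'n \<Rightarrow>\<^sub>0 nat. mon_deg t = d}"
    unfolding monomials_def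
    by (rule card_image, rule inj_onI) (metis lookup_single_eq lookup_single_not_eq zero_neq_one)
  finally show ?thesis by (simp add: card_mon_deg)
qed

section \<open>Homogeneous components of a polynomial\<close>

definition homog_part :: "nat \<Rightarrow> ('n::finite, 'k::field) mpoly \<Rightarrow> ('n, 'k) mpoly"
  where "homog_part d p = Poly_Mapping.mapp (\<lambda>t c. c when mon_deg t = d) p"

lemma lookup_homog_part: "Poly_Mapping.lookup (homog_part d p) t = (Poly_Mapping.lookup p t when mon_deg t = d)"
  by (auto simp: homog_part_def lookup_mapp when_def in_keys_iff)

lemma homog_part_in_homog: "homog_part d p \<in> homog d"
  by (simp add: homog_iff lookup_homog_part)

lemma homog_part_id: "p \<in> homog d \<Longrightarrow> homog_part d p = p"
  by (rule poly_mapping_eqI) (auto simp: homog_iff lookup_homog_part when_def)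

lemma homog_part_eq_0: "(\<And>t. t \<in> Poly_Mapping.keys p \<Longrightarrow> mon_deg t \<noteq> d) \<Longrightarrow> homog_part d p = 0"
  by (rule poly_mapping_eqI) (auto simp: lookup_homog_part when_def in_keys_iff)

lemma homog_part_add: "homog_part d (p + q) = homog_part d p + homog_part d q"
  by (rule poly_mapping_eqI) (simp add: lookup_homog_part lookup_add when_def)

lemma homog_part_diff: "homog_part d (p - q) = homog_part d p - homog_part d q"
  by (rule poly_mapping_eqI) (simp add: lookup_homog_part lookup_minus when_def)

text \<open>Multiplication by \<open>f\<close> shifts degrees by exactly e, so only the degree-d
  part of \<open>q\<close> reaches degree d + e.\<close>

lemma homog_part_mult:
  assumes "f \<in> homog e"
  shows "homog_part (d + e) (q * f) = homog_part d q * f"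
proof -
  define r where "r = q - homog_part d q"
  have "homog_part (d + e) (r * f) = 0"
  proof (rule homog_part_eq_0)
    fix t assume "t \<in> Poly_Mapping.keys (r * f)"
    then obtain a b where ab: "t = a + b" "a \<in> Poly_Mapping.keys r" "b \<in> Poly_Mapping.keys f"
      using keys_mult[of r f] by auto
    have "mon_deg a \<noteq> d" 
      using ab(2) by (auto simp: r_def in_keys_iff lookup_minus lookup_homog_part when_def)
    then show "mon_deg t \<noteq> d + e" using ab assms by (auto simp: homog_def mon_deg_add)
  qed
  moreover have "q * f = homog_part d q * f + r * f" by (simp add: r_def algebra_simps)
  ultimately show ?thesis
    by (simp add: homog_part_add homog_part_id homog_mult homog_part_in_homog assms)
qed

lemma homog_part_mult_less:
  assumes "f \<in> homog e" "d < e"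
  shows "homog_part d (q * f) = 0"
proof (rule homog_part_eq_0)
  fix t assume "t \<in> Poly_Mapping.keys (q * f)"
  then obtain a b where "t = a + b" "b \<in> Poly_Mapping.keys f"
    using keys_mult[of q f] by auto
  then show "mon_deg t \<noteq> d" using assms by (auto simp: homog_def mon_deg_add)
qed

subsection \<open>The ideals of the sequence and their quotients\<close>

lemma poly_ring_simps [simp]:
  "carrier poly_ring = UNIV" "monoid.mult poly_ring = (*)" "ring.add poly_ring = (+)"
  "one poly_ring = 1" "zero poly_ring = 0"
  by (simp_all add: ring_of_type_algebra_def)

lemma cring_poly_ring: "cring poly_ring"
  by (rule cring_from_type_algebra)

interpretation poly_ring: cring poly_ring
  by (rule cring_poly_ring)

lemma poly_ring_a_inv [simp]: "\<ominus>\<^bsub>poly_ring\<^esub> p = - p"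
  by (rule poly_ring.minus_equality) simp_all

lemma ideal_poly_ringI:
  assumes "0 \<in> I" "\<And>p q. p \<in> I \<Longrightarrow> q \<in> I \<Longrightarrow> p + q \<in> I" "\<And>p q. q \<in> I \<Longrightarrow> p * q \<in> I"
  shows "ideal I poly_ring"
proof (rule idealI)
  show "subgroup I (add_monoid poly_ring)"
    using assms assms(3)[of _ "-1"] by (intro poly_ring.add.subgroupI) auto
qed (use assms poly_ring.ring_axioms in \<open>auto simp: mult.commute\<close>)

lemma ideal_seq_ideal: "ideal (seq_ideal f i) poly_ring"
  unfolding seq_ideal_def by (rule poly_ring.genideal_ideal) simp

lemma seq_ideal_zero [simp]: "0 \<in> seq_ideal f i"
  and seq_ideal_add: "p \<in> seq_ideal f i \<Longrightarrow> q \<in> seq_ideal f i \<Longrightarrow> p + q \<in> seq_ideal f i"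
  and seq_ideal_mult: "q \<in> seq_ideal f i \<Longrightarrow> p * q \<in> seq_ideal f i"
  and seq_ideal_diff: "p \<in> seq_ideal f i \<Longrightarrow> q \<in> seq_ideal f i \<Longrightarrow> p - q \<in> seq_ideal f i"
proof -
  interpret ideal "seq_ideal f i" poly_ring by (rule ideal_seq_ideal)
  show "0 \<in> seq_ideal f i" using zero_closed by simp
  show add: "p + q \<in> seq_ideal f i" if "p \<in> seq_ideal f i" "q \<in> seq_ideal f i" for p q
    using a_closed that by simp
  show mult: "p * q \<in> seq_ideal f i" if "q \<in> seq_ideal f i" for p q
    using I_l_closed that by simp
  show "p - q \<in> seq_ideal f i" if "p \<in> seq_ideal f i" "q \<in> seq_ideal f i"
    using add[OF that(1) mult[OF that(2), of "-1"]] by simp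
qed

lemma subspace_seq_ideal: "mpoly.subspace (seq_ideal f i)"
  by (rule mpoly.subspaceI) (auto simp: seq_ideal_add seq_ideal_mult mscale_def)

lemma seq_ideal_0: "seq_ideal f 0 = {0}"
proof -
  have "seq_ideal f 0 \<subseteq> {0}"
    unfolding seq_ideal_def by (rule poly_ring.genideal_minimal) (auto intro: ideal_poly_ringI)
  then show ?thesis by auto
qed

text \<open>The right-hand side is an ideal containing all generators. Adjoining one generator at a
  time is what the later inductions on i use.\<close>

lemma seq_ideal_Suc: "seq_ideal f (Suc i) = {p + q * f (Suc i) | p q. p \<in> seq_ideal f i}"
proof
  show "seq_ideal f (Suc i) \<subseteq> {p + q * f (Suc i) | p q. p \<in> seq_ideal f i}" (is "_ \<subseteq> ?I")
    unfolding seq_ideal_def[of f "Suc i"]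
  proof (rule poly_ring.genideal_minimal)
    show "ideal ?I poly_ring"
    proof (rule ideal_poly_ringI)
      have "0 = 0 + 0 * f (Suc i)" by simp
      then show "0 \<in> ?I" using seq_ideal_zero by blast
    next
      fix a b assume "a \<in> ?I" "b \<in> ?I"
      then obtain p q p' q' where "p \<in> seq_ideal f i" "p' \<in> seq_ideal f i"
        "a = p + q * f (Suc i)" "b = p' + q' * f (Suc i)" by blast
      then have "p + p' \<in> seq_ideal f i" "a + b = (p + p') + (q + q') * f (Suc i)"
        by (simp_all add: seq_ideal_add algebra_simps)
      then show "a + b \<in> ?I" by blast
    next
      fix r a assume "a \<in> ?I"
      then obtain p q where "p \<in> seq_ideal f i" "a = p + q * f (Suc i)" by blast
      then have "r * p \<in> seq_ideal f i" "r * a = r * p + (r * q) * f (Suc i)"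
        by (simp_all add: seq_ideal_mult distrib_left mult.assoc)
      then show "r * a \<in> ?I" by blast
    qed
    show "f ` {1..Suc i} \<subseteq> ?I"
    proof
      fix x assume "x \<in> f ` {1..Suc i}"
      then consider "x \<in> f ` {1..i}" | "x = f (Suc i)" by (auto simp: le_Suc_eq)
      then show "x \<in> ?I"
      proof cases
        case 1
        then have "x \<in> seq_ideal f i"
          using poly_ring.genideal_self[of "f ` {1..i}"] by (auto simp: seq_ideal_def)
        moreover have "x = x + 0 * f (Suc i)" by simp
        ultimately show ?thesis by blast
      next
        case 2
        then have "x = 0 + 1 * f (Suc i)" by simp
        then show ?thesis using seq_ideal_zero by blast
      qed
    qed
  qed
  have gen: "f ` {1..Suc i} \<subseteq> seq_ideal f (Suc i)"
    unfolding seq_ideal_def using poly_ring.genideal_self by simp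
  have "seq_ideal f i \<subseteq> seq_ideal f (Suc i)"
    unfolding seq_ideal_def[of f i]
    by (rule poly_ring.genideal_minimal[OF ideal_seq_ideal]) (use gen in force)
  moreover have "f (Suc i) \<in> seq_ideal f (Suc i)" using gen by auto
  ultimately show "{p + q * f (Suc i) | p q. p \<in> seq_ideal f i} \<subseteq> seq_ideal f (Suc i)"
    by (auto intro!: seq_ideal_add seq_ideal_mult)
qed

text \<open>Extracting degree d from \<open>q * f (Suc i)\<close> replaces \<open>q\<close> by its
  part of degree d - e, or kills the product when d < e; so ideals with generators of degree e are
  homogeneous.\<close>

lemma homog_part_seq_ideal:
  assumes "\<forall>j\<in>{1..i}. f j \<in> homog e" "p \<in> seq_ideal f i"
  shows "homog_part d p \<in> seq_ideal f i"
  using assms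
proof (induction i arbitrary: p d)
  case 0
  then show ?case by (auto simp: seq_ideal_0 intro: homog_part_eq_0)
next
  case (Suc i)
  then obtain a q where p: "a \<in> seq_ideal f i" "p = a + q * f (Suc i)"
    by (auto simp: seq_ideal_Suc)
  have f: "f (Suc i) \<in> homog e" using Suc.prems by simp
  have "homog_part d a \<in> seq_ideal f i" using Suc p by simp
  moreover have "\<exists>q'. homog_part d (q * f (Suc i)) = q' * f (Suc i)"
  proof (cases "d < e")
    case True
    then have "homog_part d (q * f (Suc i)) = 0 * f (Suc i)" using homog_part_mult_less[OF f] by simp
    then show ?thesis by blast
  next
    case False
    then show ?thesis using homog_part_mult[OF f, of "d - e" q] by auto
  qed
  ultimately show ?case unfolding p(2) seq_ideal_Suc homog_part_add by fastforce
qed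

text \<open>Projection to degree d + e makes the cofactor \<open>q\<close> homogeneous. The
  right-hand side then has the shape required by \<open>dim_plus_image\<close>.\<close>

lemma seq_ideal_Suc_homog:
  assumes "\<forall>j\<in>{1..Suc i}. f j \<in> homog e"
  shows "seq_ideal f (Suc i) \<inter> homog (d + e) =
    {p + q * f (Suc i) | p q. p \<in> seq_ideal f i \<inter> homog (d + e) \<and> q \<in> homog d}" (is "?L = ?R")
proof
  have f: "f (Suc i) \<in> homog e" using assms by simp
  show "?L \<subseteq> ?R"
  proof
    fix x assume x: "x \<in> ?L"
    then obtain p q where "p \<in> seq_ideal f i" "x = p + q * f (Suc i)" by (auto simp: seq_ideal_Suc)
    then have "x = homog_part (d + e) p + homog_part d q * f (Suc i)"
      using x homog_part_id[of x "d + e"] by (simp add: homog_part_add homog_part_mult[OF f])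
    moreover have "homog_part (d + e) p \<in> seq_ideal f i"
      using homog_part_seq_ideal[of i f e p] \<open>p \<in> seq_ideal f i\<close> assms by simp
    ultimately show "x \<in> ?R"
      using homog_part_in_homog[of "d + e" p] homog_part_in_homog[of d q] by blast
  qed
  show "?R \<subseteq> ?L"
    using f by (auto simp: seq_ideal_Suc intro: homog_mult mpoly.subspace_add[OF subspace_homog])
qed

text \<open>Supplies the degrees below e, which are not of the form d + e.\<close>

lemma seq_ideal_homog_less:
  assumes "\<forall>j\<in>{1..i}. f j \<in> homog e" "d < e"
  shows "seq_ideal f i \<inter> homog d = {0}"
proof -
  have "homog_part d p = 0" if "p \<in> seq_ideal f i" for p
    using that assms
  proof (induction i arbitrary: p)
    case 0
    then show ?case by (auto simp: seq_ideal_0 intro: homog_part_eq_0)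
  next
    case (Suc i)
    then obtain a q where "a \<in> seq_ideal f i" "p = a + q * f (Suc i)"
      by (auto simp: seq_ideal_Suc)
    moreover have "homog_part d (q * f (Suc i)) = 0"
      using Suc.prems by (intro homog_part_mult_less) auto
    ultimately show ?case using Suc by (simp add: homog_part_add)
  qed
  then show ?thesis 
    using homog_part_id mpoly.subspace_0[OF subspace_homog] by fastforce
qed

section \<open>Cosets modulo the ideals of the sequence\<close>

lemma seq_class_eq_iff: "seq_class f i p = seq_class f i q \<longleftrightarrow> p - q \<in> seq_ideal f i"
proof -
  have *: "seq_class f i p = {h + p | h. h \<in> seq_ideal f i}" for p
    by (auto simp: seq_class_def a_r_coset_def r_coset_def)
  show ?thesis
  proof
    assume "seq_class f i p = seq_class f i q"
    moreover have "p = 0 + p" by simp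
    then have "p \<in> seq_class f i p" unfolding * using seq_ideal_zero by blast
    ultimately show "p - q \<in> seq_ideal f i" by (auto simp: *)
  next
    assume A: "p - q \<in> seq_ideal f i"
    have "h + p = (h + (p - q)) + q" "h + q = (h - (p - q)) + p" for h by simp_all
    then show "seq_class f i p = seq_class f i q"
      unfolding * using seq_ideal_add[OF _ A] seq_ideal_diff[OF _ A] by blast
  qed
qed

lemma seq_class_mult:
  "seq_class f i p \<otimes>\<^bsub>seq_quot f i\<^esub> seq_class f i q = seq_class f i (p * q)"
  using ideal.rcoset_mult_add[OF ideal_seq_ideal, of p q f i]
  by (simp add: seq_quot_def FactRing_def seq_class_def)

lemma seq_class_add:
  "seq_class f i p \<oplus>\<^bsub>seq_quot f i\<^esub> seq_class f i q = seq_class f i (p + q)"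
  using abelian_subgroup.a_rcos_sum[OF ideal.axioms(1)[OF ideal_seq_ideal, THEN abelian_subgroupI3], of p q]
    poly_ring.abelian_group_axioms
  by (simp add: seq_quot_def FactRing_def seq_class_def)

lemma carrier_seq_quot: "carrier (seq_quot f i) = range (seq_class f i)"
  by (auto simp: seq_quot_def FactRing_def A_RCOSETS_defs seq_class_def a_r_coset_def r_coset_def)

lemma zero_seq_quot: "\<zero>\<^bsub>seq_quot f i\<^esub> = seq_class f i 0"
  by (auto simp: seq_quot_def FactRing_def seq_class_def a_r_coset_def r_coset_def)

lemma ring_seq_quot: "ring (seq_quot f i)"
  unfolding seq_quot_def by (rule ideal.quotient_is_ring[OF ideal_seq_ideal])

text \<open>Injectivity is applied to the classes of \<open>g\<close> and 0, which turns it into a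
  statement about ideal membership.\<close>

lemma semi_regularD:
  assumes "semi_regular f m" "i < m" "j + 2 < deg_reg f m"
    and "g \<in> homog j" "g * f (Suc i) \<in> seq_ideal f i"
  shows "g \<in> seq_ideal f i"
proof -
  have inj: "inj_on (\<lambda>C. C \<otimes>\<^bsub>seq_quot f i\<^esub> seq_class f i (f (Suc i))) (seq_quot_homog f i j)"
    using assms(1-3) unfolding semi_regular_def by (auto dest!: bspec[of _ _ "Suc i"])
  have eq: "seq_class f i g \<otimes>\<^bsub>seq_quot f i\<^esub> seq_class f i (f (Suc i)) =
      seq_class f i 0 \<otimes>\<^bsub>seq_quot f i\<^esub> seq_class f i (f (Suc i))"
    using assms(5) by (simp add: seq_class_mult seq_class_eq_iff)
  have "seq_class f i g = seq_class f i 0"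
    by (rule inj_onD[OF inj eq])
      (use assms(4) mpoly.subspace_0[OF subspace_homog] in \<open>auto simp: seq_quot_homog_def\<close>)
  then show ?thesis by (simp add: seq_class_eq_iff)
qed

text \<open>All classes have representatives of degree at most some \<open>D\<close>. A form
  \<open>g\<close> of degree D + 1 is congruent to such a \<open>p\<close>, and the component of
  \<open>g - p\<close> in degree D + 1 is \<open>g\<close> itself. Hence the minimum defining
  \<open>deg_reg\<close> is attained.\<close>

lemma homog_subset_seq_ideal:
  assumes "\<forall>j\<in>{1..m}. f j \<in> homog e" "seq_quot_finite_dim f m"
  shows "\<exists>d. homog d \<subseteq> seq_ideal f m"
proof -
  interpret Q: ring "seq_quot f m" by (rule ring_seq_quot)
  \<comment> \<open>Each line extension adds multiples of one vector, so the degree bound grows at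
    most to the degree of one representative of it.\<close>
  have bound: "\<exists>D. \<forall>C\<in>E. \<exists>p. C = seq_class f m p \<and> (\<forall>t\<in>Poly_Mapping.keys p. mon_deg t \<le> D)"
    if "Q.dimension n K E" "K = seq_class f m ` scalars" for n K E
    using that
  proof (induction rule: Q.dimension.induct)
    case (zero_dim K)
    show ?case by (rule exI[of _ 0]) (auto simp: zero_seq_quot intro!: exI[of _ 0])
  next
    case (Suc_dim v E n K)
    then obtain D where D: "\<forall>C\<in>E. \<exists>p. C = seq_class f m p \<and> (\<forall>t\<in>Poly_Mapping.keys p. mon_deg t \<le> D)"
      by blast
    obtain q where q: "v = seq_class f m q" using Suc_dim.hyps by (auto simp: carrier_seq_quot)
    obtain B where B: "\<forall>t\<in>Poly_Mapping.keys q. mon_deg t \<le> B"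
      using finite_keys[of q] by (meson finite_imageI finite_nat_set_iff_bounded_le imageI)
    show ?case
    proof (intro exI[of _ "max D B"] ballI)
      fix C assume "C \<in> Q.line_extension K v E"
      then obtain c C' where C: "C' \<in> E"
        "C = seq_class f m (Poly_Mapping.single 0 c) \<otimes>\<^bsub>seq_quot f m\<^esub> v \<oplus>\<^bsub>seq_quot f m\<^esub> C'"
        using Suc_dim.prems by (auto simp: Q.line_extension_mem_iff scalars_def)
      then obtain p where p: "C' = seq_class f m p" "\<forall>t\<in>Poly_Mapping.keys p. mon_deg t \<le> D"
        using D by blast
      have "C = seq_class f m (mscale c q + p)"
        by (simp add: C q p seq_class_mult seq_class_add mscale_def)
      moreover have "mon_deg t \<le> max D B" if "t \<in> Poly_Mapping.keys (mscale c q + p)" for t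
      proof -
        have "t \<in> Poly_Mapping.keys q \<or> t \<in> Poly_Mapping.keys p"
          using that by (auto simp: in_keys_iff lookup_add)
        then show ?thesis using p B by (auto simp: max.coboundedI1 max.coboundedI2)
      qed
      ultimately show "\<exists>p. C = seq_class f m p \<and> (\<forall>t\<in>Poly_Mapping.keys p. mon_deg t \<le> max D B)"
        by blast
    qed
  qed
  obtain n where "Q.dimension n (seq_class f m ` scalars) (carrier (seq_quot f m))"
    using assms(2) by (auto simp: seq_quot_finite_dim_def Q.finite_dimension_def)
  from bound[OF this refl] obtain D where D: "\<And>C. C \<in> carrier (seq_quot f m) \<Longrightarrow>
      \<exists>p. C = seq_class f m p \<and> (\<forall>t\<in>Poly_Mapping.keys p. mon_deg t \<le> D)" by blast
  have "homog (Suc D) \<subseteq> seq_ideal f m"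
  proof
    fix g assume g: "g \<in> (homog (Suc D) :: ('a, 'b) mpoly set)"
    obtain p where p: "seq_class f m g = seq_class f m p" "\<forall>t\<in>Poly_Mapping.keys p. mon_deg t \<le> D"
      using D[of "seq_class f m g"] by (auto simp: carrier_seq_quot)
    then have "homog_part (Suc D) (g - p) \<in> seq_ideal f m"
      using homog_part_seq_ideal assms(1) by (simp add: seq_class_eq_iff)
    moreover have "homog_part (Suc D) p = 0" using p(2) by (intro homog_part_eq_0) fastforce
    ultimately show "g \<in> seq_ideal f m" using g by (simp add: homog_part_diff homog_part_id)
  qed
  then show ?thesis by blast
qed

section \<open>Dimension over the scalars in the sense of \<open>ring.dim\<close>\<close>

lemma subfield_scalars: "subfield scalars poly_ring"
proof (rule poly_ring.subfieldI)
  show sub: "subcring scalars poly_ring"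
  proof (rule poly_ring.subcringI', rule poly_ring.subringI)
    show "\<one>\<^bsub>poly_ring\<^esub> \<in> scalars" unfolding scalars_def by (simp flip: single_one)
  qed (auto simp: scalars_def mult_single single_uminus[symmetric] single_add[symmetric])
  show "Units (poly_ring\<lparr>carrier := scalars\<rparr>) = scalars - {\<zero>\<^bsub>poly_ring\<^esub>}"
  proof
    show "Units (poly_ring\<lparr>carrier := scalars\<rparr>) \<subseteq> scalars - {\<zero>\<^bsub>poly_ring\<^esub>}"
      by (auto simp: Units_def)
    show "scalars - {\<zero>\<^bsub>poly_ring\<^esub>} \<subseteq> Units (poly_ring\<lparr>carrier := scalars\<rparr>)"
    proof
      fix x assume "x \<in> scalars - {\<zero>\<^bsub>poly_ring\<^esub>}"
      then obtain c where x: "x = Poly_Mapping.single 0 c" "c \<noteq> 0" using single_zero by (fastforce simp: scalars_def)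
      then have "Poly_Mapping.single 0 (inverse c) * x = 1" "x * Poly_Mapping.single 0 (inverse c) = 1"
        by (simp_all add: mult_single)
      then show "x \<in> Units (poly_ring\<lparr>carrier := scalars\<rparr>)"
        using x by (auto simp: Units_def scalars_def)
    qed
  qed
qed

lemma subalgebra_scalarsI: "mpoly.subspace V \<Longrightarrow> subalgebra scalars V poly_ring"
proof (intro subalgebra.intro subalgebra_axioms.intro)
  assume V: "mpoly.subspace V"
  show "subgroup V (add_monoid poly_ring)"
    using V mpoly.subspace_0[OF V]
    by (intro poly_ring.add.subgroupI) (auto simp: mpoly.subspace_add mpoly.subspace_neg)
  show "k \<otimes>\<^bsub>poly_ring\<^esub> v \<in> V" if "k \<in> scalars" "v \<in> V" for k v
    using mpoly.subspace_scale[OF V] that by (auto simp: scalars_def mscale_def)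
qed

text \<open>A base of \<open>V\<close> is an independent family in \<open>E\<close> of full length,
  so it spans \<open>E\<close> as well.\<close>

lemma (in ring) subalgebra_eq_of_dim_eq:
  assumes "subfield K R" "finite_dimension K E" "subalgebra K V R" "V \<subseteq> E" "dim K V = dim K E"
  shows "V = E"
proof -
  have "dimension (dim K E) K V" "dimension (dim K E) K E"
    using assms finite_dimensionE[OF assms(1), unfolded over_def]
      subalbegra_incl_imp_finite_dimension[OF assms(1-4)] by metis+
  then show ?thesis
    using exists_base[OF assms(1)] independent_length_eq_dimension[OF assms(1)] Span_base_incl[OF assms(1)]
      assms(4) by (metis subset_trans)
qed

text \<open>The two notions of span meet here: the algebraic \<open>Span\<close> of the monomials is
  an \<open>mpoly\<close> subspace, so it contains their \<open>mpoly.span\<close>.\<close>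

lemma finite_dimension_homog: "ring.finite_dimension poly_ring scalars (homog d)"
proof -
  obtain Us :: "('a, 'b) mpoly list" where Us: "set Us = monomials d"
    using finite_list[OF finite_monomials] by blast
  let ?S = "poly_ring.Span scalars Us"
  have sub: "subalgebra scalars ?S poly_ring"
    using subfield_scalars by (intro poly_ring.Span_is_subalgebra) auto
  interpret S: subalgebra scalars ?S poly_ring by (rule sub)
  have "mpoly.subspace ?S"
    using S.one_closed S.m_closed S.smult_closed
    by (intro mpoly.subspaceI) (auto simp: mscale_def scalars_def)
  moreover have "monomials d \<subseteq> ?S"
    using poly_ring.Span_base_incl[OF subfield_scalars, of Us] Us by simp
  ultimately have "homog d \<subseteq> ?S" using homog_subset_span mpoly.span_minimal by blast
  moreover have "poly_ring.finite_dimension scalars ?S"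
    using poly_ring.Span_finite_dimension[OF subfield_scalars, of Us] by simp
  ultimately show ?thesis
    using poly_ring.subalbegra_incl_imp_finite_dimension[OF subfield_scalars]
      subalgebra_scalarsI[OF subspace_homog] by blast
qed

text \<open>Inside the finite-dimensional \<open>homog d\<close>, equal dimension means equal space,
  so \<open>ring.dim\<close> and \<open>mpoly.dim\<close> never have to be compared.\<close>

lemma deg_reg_eq:
  fixes f :: "nat \<Rightarrow> ('n::finite, 'k::field) mpoly"
  shows "deg_reg f m = (LEAST d. homog d \<subseteq> seq_ideal f m)"
proof -
  have "ring.dim poly_ring scalars (seq_ideal f m \<inter> homog d) =
      ring.dim poly_ring scalars (homog d :: ('n, 'k) mpoly set) \<longleftrightarrow> homog d \<subseteq> seq_ideal f m" for d
  proof
    assume "ring.dim poly_ring scalars (seq_ideal f m \<inter> homog d) =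
      ring.dim poly_ring scalars (homog d :: ('n, 'k) mpoly set)"
    then have "seq_ideal f m \<inter> homog d = homog d"
      by (intro poly_ring.subalgebra_eq_of_dim_eq[OF subfield_scalars finite_dimension_homog]
          subalgebra_scalarsI mpoly.subspace_inter subspace_seq_ideal subspace_homog Int_lower2)
    then show "homog d \<subseteq> seq_ideal f m" by blast
  qed (simp add: Int_absorb1)
  then show ?thesis by (simp add: deg_reg_def)
qed

subsection \<open>Hilbert functions\<close>

text \<open>This is the dimension of the degree-d component of the quotient by the first i forms,
  written as a codimension to avoid quotient spaces. Integer values keep differences from
  truncating.\<close>

definition hilbert :: "(nat \<Rightarrow> ('n::finite, 'k::field) mpoly) \<Rightarrow> nat \<Rightarrow> nat \<Rightarrow> int"
  where "hilbert f i d = int (mpoly.dim (homog d :: ('n, 'k) mpoly set))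
    - int (mpoly.dim (seq_ideal f i \<inter> homog d))"

text \<open>\<open>dim_plus_image\<close> is applied to multiplication by \<open>f (Suc i)\<close>.
  The excess of \<open>K\<close> over the degree-d part of the ideal is the kernel on the quotient,
  which is zero in the injective case.\<close>

lemma hilbert_Suc:
  fixes f :: "nat \<Rightarrow> ('n::finite, 'k::field) mpoly"
  assumes "\<forall>j\<in>{1..Suc i}. f j \<in> homog e"
  shows "hilbert f (Suc i) (d + e) \<ge> hilbert f i (d + e) - hilbert f i d"
    and "(\<And>g. g \<in> homog d \<Longrightarrow> g * f (Suc i) \<in> seq_ideal f i \<Longrightarrow> g \<in> seq_ideal f i) \<Longrightarrow>
      hilbert f (Suc i) (d + e) = hilbert f i (d + e) - hilbert f i d"
proof -
  define K where "K = {g \<in> homog d. g * f (Suc i) \<in> seq_ideal f i \<inter> homog (d + e)}"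
  have f: "f (Suc i) \<in> homog e" using assms by simp
  have "mpoly.dim (seq_ideal f (Suc i) \<inter> homog (d + e)) + mpoly.dim K =
      mpoly.dim (seq_ideal f i \<inter> homog (d + e)) + mpoly.dim (homog d :: ('n, 'k) mpoly set)"
    unfolding K_def seq_ideal_Suc_homog[OF assms]
    by (rule mpoly.dim_plus_image[OF linear_mult_right _ subspace_homog _ finite_monomials
          homog_subset_span finite_monomials])
      (use homog_subset_span in \<open>auto intro!: mpoly.subspace_inter subspace_seq_ideal subspace_homog\<close>)
  then have eq: "hilbert f (Suc i) (d + e) = hilbert f i (d + e) - hilbert f i d
      + (int (mpoly.dim K) - int (mpoly.dim (seq_ideal f i \<inter> homog d)))"
    by (simp add: hilbert_def)
  have sub: "seq_ideal f i \<inter> homog d \<subseteq> K"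
    unfolding K_def using homog_mult[OF _ f] seq_ideal_mult[of _ f i "f (Suc i)"]
    by (auto simp: mult.commute)
  have "mpoly.dim (seq_ideal f i \<inter> homog d) \<le> mpoly.dim K"
    by (rule mpoly.dim_mono_finite_span[OF sub _ finite_monomials])
      (use homog_subset_span in \<open>auto simp: K_def\<close>)
  then show "hilbert f (Suc i) (d + e) \<ge> hilbert f i (d + e) - hilbert f i d"
    using eq by simp
  assume "\<And>g. g \<in> homog d \<Longrightarrow> g * f (Suc i) \<in> seq_ideal f i \<Longrightarrow> g \<in> seq_ideal f i"
  then have "K = seq_ideal f i \<inter> homog d" using sub by (auto simp: K_def)
  then show "hilbert f (Suc i) (d + e) = hilbert f i (d + e) - hilbert f i d"
    using eq by simp
qed

lemma hilbert_less:
  fixes f :: "nat \<Rightarrow> ('n::finite, 'k::field) mpoly"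
  assumes "\<forall>j\<in>{1..i}. f j \<in> homog e" "d < e"
  shows "hilbert f i d = int (mpoly.dim (homog d :: ('n, 'k) mpoly set))"
proof -
  have "mpoly.dim {0 :: ('n, 'k) mpoly} = 0"
    by (rule mpoly.dim_unique[of "{}"]) (auto simp: mpoly.span_zero mpoly.independent_empty)
  then show ?thesis by (simp add: hilbert_def seq_ideal_homog_less[OF assms])
qed

lemma hilbert_0:
  fixes f :: "nat \<Rightarrow> ('n::finite, 'k::field) mpoly"
  shows "hilbert f 0 d = int (mpoly.dim (homog d :: ('n, 'k) mpoly set))"
  using hilbert_less[of 0 f "Suc d" d] by simp

lemma krawtchouk_nth_deg_reg_nonpos:
  includes fps_syntax
  fixes f :: "nat \<Rightarrow> ('n::finite, 'k::field) mpoly"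
  assumes "CARD('n) < m" and quad: "\<forall>i\<in>{1..m}. f i \<in> homog 2"
    and "seq_quot_finite_dim f m" and reg: "semi_regular f m"
  shows "((1 - fps_X) ^ (m - CARD('n)) * (1 + fps_X) ^ m :: real fps) $ deg_reg f m \<le> 0"
proof -
  define n D where "n = CARD('n)" and "D = deg_reg f m"
  \<comment> \<open>\<open>T i\<close> is the Hilbert series that the quotient by i quadrics would
    have if every multiplication were injective.\<close>
  define T where "T i = inverse ((1 - fps_X) ^ n) * (1 - fps_X\<^sup>2 :: real fps) ^ i" for i
  have n: "n > 0" by (simp add: n_def)
  have T0: "T 0 $ d = real_of_int (hilbert f 0 d)" for d
    using one_minus_const_fps_X_neg_power'[OF n, of "1 :: real"]
    by (simp add: T_def hilbert_0 dim_homog n_def add.commute)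
  have TSuc: "T (Suc i) $ d = T i $ d - (if d < 2 then 0 else T i $ (d - 2))" for i d
  proof -
    have "T (Suc i) = T i - T i * fps_X\<^sup>2" by (simp add: T_def algebra_simps)
    then show ?thesis by (simp add: fps_X_power_mult_right_nth)
  qed
  have step: "hilbert f (Suc i) d \<ge> hilbert f i d - (if d < 2 then 0 else hilbert f i (d - 2))"
    "d < D \<Longrightarrow> hilbert f (Suc i) d = hilbert f i d - (if d < 2 then 0 else hilbert f i (d - 2))"
    if "i < m" for i d
  proof -
    have q: "\<forall>j\<in>{1..Suc i}. f j \<in> homog 2" "\<forall>j\<in>{1..i}. f j \<in> homog 2" using quad that by auto
    have less: "hilbert f (Suc i) d = hilbert f i d" if "d < 2"
      using hilbert_less[OF q(1) that] hilbert_less[OF q(2) that] by simp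
    have d: "d - 2 + 2 = d" if "\<not> d < 2" using that by simp
    show "hilbert f (Suc i) d \<ge> hilbert f i d - (if d < 2 then 0 else hilbert f i (d - 2))"
    proof (cases "d < 2")
      case False
      then show ?thesis using hilbert_Suc(1)[OF q(1), of "d - 2", unfolded d[OF False]] by simp
    qed (use less in simp)
    show "hilbert f (Suc i) d = hilbert f i d - (if d < 2 then 0 else hilbert f i (d - 2))" if "d < D"
    proof (cases "d < 2")
      case False
      have "hilbert f (Suc i) ((d - 2) + 2) = hilbert f i ((d - 2) + 2) - hilbert f i (d - 2)"
        by (rule hilbert_Suc(2)[OF q(1)], rule semi_regularD[OF reg \<open>i < m\<close>, of "d - 2"])
          (use that False in \<open>auto simp: D_def\<close>)
      then show ?thesis using False by (simp only: d[OF False] if_False)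
    qed (use less in simp)
  qed
  have below: "real_of_int (hilbert f i d) = T i $ d" if "i \<le> m" "d < D" for i d
    using that by (induction i arbitrary: d) (simp_all add: T0 TSuc step(2))
  \<comment> \<open>Semi-regularity does not cover the map from degree D - 2 to D, so only an
    inequality remains. Its direction survives the induction because the subtracted term lies in
    degree D - 2, where \<open>below\<close> gives equality.\<close>
  have at: "real_of_int (hilbert f i D) \<ge> T i $ D" if "i \<le> m" for i
    using that
  proof (induction i)
    case (Suc i)
    have "real_of_int (hilbert f (Suc i) D) \<ge>
        real_of_int (hilbert f i D) - (if D < 2 then 0 else real_of_int (hilbert f i (D - 2)))"
      using step(1)[of i D] Suc.prems by (simp split: if_splits)
    then show ?case using Suc below[of i "D - 2"] by (auto simp: TSuc split: if_splits)
  qed (simp add: T0)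
  have "homog D \<subseteq> seq_ideal f m"
    unfolding D_def deg_reg_eq using homog_subset_seq_ideal[OF quad assms(3)] by (rule LeastI_ex)
  then have "hilbert f m D = 0" by (simp add: hilbert_def Int_absorb1)
  then have "T m $ D \<le> 0" using at[of m] by simp
  moreover have "T m = (1 - fps_X) ^ (m - n) * (1 + fps_X) ^ m"
  proof -
    have "(1 - fps_X\<^sup>2 :: real fps) ^ m = ((1 - fps_X) * (1 + fps_X)) ^ m"
      by (simp add: algebra_simps power2_eq_square)
    also have "\<dots> = (1 - fps_X) ^ n * ((1 - fps_X) ^ (m - n) * (1 + fps_X) ^ m)"
      using assms(1) by (simp add: n_def power_mult_distrib power_add[symmetric] mult.assoc[symmetric])
    finally have "T m = (inverse ((1 - fps_X) ^ n) * (1 - fps_X) ^ n) * ((1 - fps_X) ^ (m - n) * (1 + fps_X) ^ m)"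
      by (simp add: T_def mult.assoc)
    then show ?thesis by (simp add: inverse_mult_eq_1 fps_nth_power_0)
  qed
  ultimately show ?thesis by (simp add: n_def D_def)
qed

section \<open>From the smaller root of p to the degree bound\<close>

theorem theorem4p1:
  fixes f :: "nat \<Rightarrow> ('n::finite, 'k::field) mpoly" and m n :: nat
  assumes "n = CARD('n)"
    and "n \<ge> 1"
    and "m > n"
    and "\<forall>i\<in>{1..m}. f i \<in> homog 2"
    and "seq_quot_finite_dim f m"
    and "semi_regular f m"
  shows "let p = (\<lambda>k::real. k\<^sup>2 - (2 * real m - real n) * k + (1/4) * (real n)\<^sup>2);
             r = (1/2) * (2 * real m - real n - 2 * sqrt (real m * (real m - real n)))
         in p r = 0 \<and> (\<forall>k. p k = 0 \<longrightarrow> r \<le> k) \<and> int (deg_reg f m) \<ge> 1 + \<lfloor>r\<rfloor>"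
proof -
  define s where "s = sqrt (real m * (real m - real n))"
  define p where "p k = k\<^sup>2 - (2 * real m - real n) * k + (1/4) * (real n)\<^sup>2" for k :: real
  define r where "r = (1/2) * (2 * real m - real n - 2 * s)"
  have s: "s \<ge> 0" "s\<^sup>2 = real m * (real m - real n)" using \<open>m > n\<close> by (simp_all add: s_def)
  have rs: "r + s = (2 * real m - real n) / 2" by (simp add: r_def field_simps)
  \<comment> \<open>Completing the square: \<open>r + s\<close> is the midpoint of the two roots and
    \<open>s\<close> half their distance.\<close>
  have p: "p k = (k - (r + s))\<^sup>2 - s\<^sup>2" for k
    unfolding s(2) rs by (simp add: p_def power2_eq_square field_simps)
  have "p r = 0" by (simp add: p)
  moreover have "r \<le> k" if "p k = 0" for k
  proof -
    have "\<bar>k - (r + s)\<bar> = \<bar>s\<bar>" using that by (simp add: p power2_eq_iff abs_eq_iff)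
    then show ?thesis using s(1) by linarith
  qed
  \<comment> \<open>If the degree of regularity were at most \<open>r\<close>, the coefficient there
    would be both positive and nonpositive. The strict inequality yields the summand 1 in front of
    the floor.\<close>
  moreover have "r < real (deg_reg f m)"
  proof (rule ccontr)
    assume "\<not> r < real (deg_reg f m)"
    then have "real (deg_reg f m) \<le> (real (m - n) + real m) / 2 - sqrt (real (m - n) * real m)"
      using \<open>m > n\<close> by (simp add: r_def s_def of_nat_diff mult.commute field_simps)
    then show False
      using fps_krawtchouk_nth_pos[of "m - n" m "deg_reg f m"] assms
        krawtchouk_nth_deg_reg_nonpos[of m f] by simp
  qed
  then have "1 + \<lfloor>r\<rfloor> \<le> int (deg_reg f m)" by linarith
  ultimately show ?thesis unfolding Let_def p_def r_def s_def by blast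
qed

end
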